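(* Let $K$ be a field, $V$ a vector space over $K$, $A:V\to V$ a linear operator, $n\ge 2$, $b_1,\dots,b_n\in K$ and $\varphi_1,\dots,\varphi_n\in V$. If $x_1,\dots,x_n\in V$ satisfy the system $$A(x_j)=b_jx_1+b_jx_2+\dots+b_jx_n+\varphi_j,\qquad 1\le j\le n,$$ then they satisfy $$\Delta_{\hat B}(A)(x_j)=A^{n-1}(\varphi_j)+\sum_{\substack{1\le i\le n\\ i\neq j}}\big(b_jA^{n-2}(\varphi_i)-b_iA^{n-2}(\varphi_j)\big),\qquad 1\le j\le n.$$
   Context: $\hat B\in K^{n\times n}$ is the matrix whose $(j,k)$ entry is $b_j$ for all $1\le j,k\le n$ (all entries of row $j$ equal $b_j$). $\Delta_{\hat B}(\lambda)=\det(\lambda I-\hat B)$ is its characteristic polynomial, and $\Delta_{\hat B}(A)$ is the linear operator on $V$ obtained by substituting $A$ for $\lambda$ (powers of $A$ are iterated compositions, $A^0$ is the identity). *)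

theory Defs
  imports "Jordan_Normal_Form.Char_Poly"
begin

(* Coefficient families are indexed by 1, ..., n, whereas matrix indices range over 0, ..., n - 1;
   hence the shift by Suc. *)
definition B_hat :: "nat \<Rightarrow> (nat \<Rightarrow> 'k) \<Rightarrow> 'k mat" where
  "B_hat n b = mat n n (\<lambda>(j, k). b (Suc j))"

(* The operator p(A), where scale is the scalar multiplication of the vector space. *)
definition poly_op ::
  "('k::comm_ring_1 \<Rightarrow> 'v \<Rightarrow> 'v) \<Rightarrow> 'k poly \<Rightarrow> ('v \<Rightarrow> 'v) \<Rightarrow> 'v \<Rightarrow> 'v::ab_group_add" where
  "poly_op scale p A = (\<lambda>v. \<Sum>i\<le>degree p. scale (coeff p i) ((A ^^ i) v))"

end

theory Submission
  imports Defs
begin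

text \<open>
  Write \<open>s = b\<^sub>1 + \<dots> + b\<^sub>n\<close>, \<open>S = x\<^sub>1 + \<dots> + x\<^sub>n\<close> and \<open>\<Phi> = \<phi>\<^sub>1 + \<dots> + \<phi>\<^sub>n\<close>.  The system
  sees the unknowns on its right-hand side only through \<open>S\<close>, since it reads \<open>A x\<^sub>j = b\<^sub>j S + \<phi>\<^sub>j\<close>.
  Adding the equations gives \<open>A S = s S + \<Phi>\<close>, and eliminating \<open>S\<close> leaves the second-order identity
  \<open>A\<^sup>2 x\<^sub>j - s A x\<^sub>j = A \<phi>\<^sub>j + b\<^sub>j \<Phi> - s \<phi>\<^sub>j\<close> (lemma \<open>elimination_of_sum\<close>).

  On the other side, \<open>B_hat\<close> has rank at most one and trace \<open>s\<close>, so its characteristic polynomial is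
  \<open>\<lambda>\<^sup>n - s \<lambda>\<^bsup>n-1\<^esup> = \<lambda>\<^bsup>n-2\<^esup> (\<lambda>\<^sup>2 - s \<lambda>)\<close> (lemma \<open>char_poly_B_hat\<close>).  Applying \<open>A\<^bsup>n-2\<^esup>\<close> to
  the second-order identity is therefore all that remains; the index \<open>i = j\<close> is missing from the
  final sum because its contribution \<open>b\<^sub>j \<phi>\<^sub>j - b\<^sub>j \<phi>\<^sub>j\<close> cancels.
\<close>

text \<open>
  Conjugating by the unipotent matrix \<open>P\<close> that replaces the last coordinate by the sum of all
  coordinates makes the matrix upper triangular: a matrix with constant rows factors through
  the functional ``sum of the coordinates'', which becomes the last coordinate.
  Stated over an arbitrary domain so that it applies directly to the polynomial matrix
  \<open>\<lambda> I - B\<close>.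
\<close>

lemma det_scalar_minus_constant_rows:
  fixes c :: "'a::idom" and u :: "nat \<Rightarrow> 'a"
  shows "det (mat (Suc m) (Suc m) (\<lambda>(i, j). (if i = j then c else 0) - u i)) =
    c ^ m * (c - (\<Sum>i\<le>m. u i))"
proof -
  define M where "M = mat (Suc m) (Suc m) (\<lambda>(i, j). (if i = j then c else 0) - u i)"
  define P where "P = mat (Suc m) (Suc m) (\<lambda>(i, j). if i = j \<or> i = m then 1 else (0::'a))"
  define T where "T = mat (Suc m) (Suc m) (\<lambda>(i, j).
    if i = m then (if j = m then c - (\<Sum>i\<le>m. u i) else 0)
    else (if i = j then c else 0) - (if j = m then u i else 0))"
  have carrier: "M \<in> carrier_mat (Suc m) (Suc m)" "P \<in> carrier_mat (Suc m) (Suc m)"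
    "T \<in> carrier_mat (Suc m) (Suc m)"
    by (auto simp: M_def P_def T_def)
  \<comment> \<open>The relation \<open>P M P\<inverse> = T\<close> in a form that avoids computing \<open>P\<inverse>\<close>.\<close>
  have intertwine: "P * M = T * P"
  proof (rule eq_matI)
    fix i j assume "i < dim_row (T * P)" "j < dim_col (T * P)"
    then have ij: "i < Suc m" "j < Suc m" using carrier by auto
    have PM: "(P * M) $$ (i, j) =
        (\<Sum>k<Suc m. (if i = k \<or> i = m then 1 else 0) * ((if k = j then c else 0) - u k))"
      using ij by (simp add: P_def M_def scalar_prod_def lessThan_atLeast0 del: sum.op_ivl_Suc)
    have TP: "(T * P) $$ (i, j) =
        (\<Sum>k<Suc m. (if i = m then (if k = m then c - (\<Sum>i\<le>m. u i) else 0)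
          else (if i = k then c else 0) - (if k = m then u i else 0)) *
          (if k = j \<or> k = m then 1 else 0))"
      using ij by (simp add: P_def T_def scalar_prod_def lessThan_atLeast0 del: sum.op_ivl_Suc)
    show "(P * M) $$ (i, j) = (T * P) $$ (i, j)"
    proof (cases "i = m")
      case True
      have "(P * M) $$ (i, j) = (\<Sum>k<Suc m. (if k = j then c else 0)) - (\<Sum>k<Suc m. u k)"
        unfolding PM using True by (simp add: sum_subtractf del: sum.lessThan_Suc)
      also have "\<dots> = c - (\<Sum>k\<le>m. u k)"
        using ij by (simp add: lessThan_Suc_atMost del: sum.lessThan_Suc)
      also have "\<dots> = (T * P) $$ (i, j)"
        unfolding TP using True by (simp add: if_distrib cong: if_cong)
      finally show ?thesis .
    next
      case False
      have "(P * M) $$ (i, j) = (\<Sum>k<Suc m. if k = i then (if k = j then c else 0) - u k else 0)"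
        unfolding PM using False by (intro sum.cong) auto
      also have "\<dots> = (if i = j then c else 0) - u i"
        using ij by (simp del: sum.lessThan_Suc)
      also have "\<dots> = (\<Sum>k<Suc m. (if k = i then (if i = j then c else 0) else 0) -
          (if k = m then u i else 0))"
        using ij by (simp add: sum_subtractf del: sum.lessThan_Suc)
      also have "\<dots> = (T * P) $$ (i, j)"
        unfolding TP using False by (intro sum.cong) auto
      finally show ?thesis .
    qed
  qed (use carrier in auto)
  have detP: "det P = 1"
  proof -
    have "det P = prod_list (diag_mat P)"
      using carrier(2) by (rule det_lower_triangular[rotated]) (auto simp: P_def)
    also have "\<dots> = (\<Prod>i<Suc m. P $$ (i, i))"
      using carrier(2) by (simp add: prod_list_diag_prod lessThan_atLeast0)
    also have "\<dots> = 1" by (rule prod.neutral) (simp add: P_def)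
    finally show ?thesis .
  qed
  have detT: "det T = c ^ m * (c - (\<Sum>i\<le>m. u i))"
  proof -
    have "det T = prod_list (diag_mat T)"
      using carrier(3) by (intro det_upper_triangular) (auto simp: T_def upper_triangular_def)
    also have "\<dots> = (\<Prod>i<Suc m. T $$ (i, i))"
      using carrier(3) by (simp add: prod_list_diag_prod lessThan_atLeast0)
    also have "\<dots> = (\<Prod>i<m. T $$ (i, i)) * T $$ (m, m)" by simp
    also have "(\<Prod>i<m. T $$ (i, i)) = (\<Prod>i<m. c)" by (rule prod.cong) (simp_all add: T_def)
    finally show ?thesis by (simp add: T_def)
  qed
  have "det P * det M = det T * det P"
    using intertwine det_mult[OF carrier(2,1)] det_mult[OF carrier(3,2)] by metis
  then have "det M = det T" using detP by simp
  then show ?thesis using detT by (simp add: M_def)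
qed

lemma char_poly_B_hat:
  fixes b :: "nat \<Rightarrow> 'k::field"
  shows "char_poly (B_hat (Suc m) b) = monom 1 (Suc m) - monom (\<Sum>i=1..Suc m. b i) m"
proof -
  have "char_poly_matrix (B_hat (Suc m) b) =
      mat (Suc m) (Suc m) (\<lambda>(i, j). (if i = j then monom 1 1 else 0) - [:b (Suc i):])"
    by (rule eq_matI) (auto simp: char_poly_matrix_def B_hat_def x_as_monom[symmetric] monom_Suc)
  then have "char_poly (B_hat (Suc m) b) =
      monom 1 1 ^ m * (monom 1 1 - (\<Sum>i\<le>m. [:b (Suc i):]))"
    by (simp only: char_poly_def det_scalar_minus_constant_rows)
  also have "(\<Sum>i\<le>m. [:b (Suc i):]) = monom (\<Sum>i\<le>m. b (Suc i)) 0"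
    by (rule poly_eqI) (auto simp: coeff_sum monom_0 coeff_pCons split: nat.split)
  also have "(\<Sum>i\<le>m. b (Suc i)) = (\<Sum>i=1..Suc m. b i)"
    by (rule sum.reindex_bij_witness[of _ "\<lambda>i. i - 1" Suc]) auto
  finally show ?thesis
    by (simp add: monom_power mult_monom right_diff_distrib del: sum.cl_ivl_Suc)
qed

lemma (in vector_space) poly_op_monom_minus_monom:
  "poly_op scale (monom 1 (Suc m) - monom s m) A v = (A ^^ Suc m) v - scale s ((A ^^ m) v)"
proof -
  let ?p = "monom 1 (Suc m) - monom s m"
  have "degree ?p = Suc m"
  proof (rule antisym)
    show "degree ?p \<le> Suc m" by (rule degree_le) auto
    show "Suc m \<le> degree ?p" by (rule le_degree) simp
  qed
  then have "poly_op scale ?p A v = (\<Sum>i\<le>Suc m. scale (coeff ?p i) ((A ^^ i) v))"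
    by (simp only: poly_op_def)
  also have "\<dots> = (\<Sum>i<m. scale (coeff ?p i) ((A ^^ i) v)) - scale s ((A ^^ m) v) + (A ^^ Suc m) v"
    by (simp add: lessThan_Suc_atMost[symmetric] scale_minus_left)
  also have "(\<Sum>i<m. scale (coeff ?p i) ((A ^^ i) v)) = 0"
    by (rule sum.neutral) auto
  finally show ?thesis by (simp add: algebra_simps)
qed

lemma linear_funpow:
  assumes "Vector_Spaces.linear scale scale A"
  shows "Vector_Spaces.linear scale scale (A ^^ m)"
proof (induction m)
  case 0
  interpret Vector_Spaces.linear scale scale A by fact
  show ?case using vs1.linear_id by (simp add: id_def)
next
  case (Suc m)
  show ?case unfolding funpow.simps by (rule Vector_Spaces.linear_compose[OF Suc assms])
qed

text \<open>
  Both \<open>A (A x\<^sub>j)\<close> and \<open>s A x\<^sub>j\<close> contain the term \<open>b\<^sub>j s S\<close>, so the unknowns drop out of their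
  difference.  Distributing \<open>b\<^sub>j \<Phi> - s \<phi>\<^sub>j\<close> over the indices puts the remainder in pairwise form.
\<close>

lemma elimination_of_sum:
  assumes "Vector_Spaces.linear scale scale A"
    and "finite I"
    and system: "\<And>j. j \<in> I \<Longrightarrow> A (x j) = scale (b j) (sum x I) + \<phi> j"
    and "j \<in> I"
  shows "A (A (x j)) - scale (sum b I) (A (x j)) =
    A (\<phi> j) + (\<Sum>i\<in>I - {j}. scale (b j) (\<phi> i) - scale (b i) (\<phi> j))"
proof -
  interpret Vector_Spaces.linear scale scale A by fact
  have A_sum: "A (sum x I) = scale (sum b I) (sum x I) + sum \<phi> I"
    by (simp add: sum system sum.distrib vs1.scale_sum_left)
  have "A (A (x j)) - scale (sum b I) (A (x j)) =
      A (\<phi> j) + (scale (b j) (sum \<phi> I) - scale (sum b I) (\<phi> j))"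
    using \<open>j \<in> I\<close>
    by (simp add: system A_sum add scale vs1.scale_right_distrib mult.commute)
  also have "scale (b j) (sum \<phi> I) - scale (sum b I) (\<phi> j) =
      (\<Sum>i\<in>I. scale (b j) (\<phi> i) - scale (b i) (\<phi> j))"
    by (simp add: sum_subtractf vs1.scale_sum_right vs1.scale_sum_left)
  also have "\<dots> = (\<Sum>i\<in>I - {j}. scale (b j) (\<phi> i) - scale (b i) (\<phi> j))"
    by (subst sum.remove[OF \<open>finite I\<close> \<open>j \<in> I\<close>]) simp
  finally show ?thesis .
qed

theorem theorem4p3:
  fixes scale :: "'k::field \<Rightarrow> 'v::ab_group_add \<Rightarrow> 'v"
    and A :: "'v \<Rightarrow> 'v"
    and n :: nat
    and b :: "nat \<Rightarrow> 'k"
    and \<phi> x :: "nat \<Rightarrow> 'v"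
  assumes "Vector_Spaces.vector_space scale"
    and "Vector_Spaces.linear scale scale A"
    and "n \<ge> 2"
    and "\<forall>j\<in>{1..n}. A (x j) = (\<Sum>k=1..n. scale (b j) (x k)) + \<phi> j"
  shows "\<forall>j\<in>{1..n}. poly_op scale (char_poly (B_hat n b)) A (x j) =
    (A ^^ (n - 1)) (\<phi> j) +
    (\<Sum>i\<in>{1..n} - {j}. scale (b j) ((A ^^ (n - 2)) (\<phi> i)) - scale (b i) ((A ^^ (n - 2)) (\<phi> j)))"
proof
  fix j assume j: "j \<in> {1..n}"
  interpret vector_space scale by fact
  define m where "m = n - 2"
  have n: "n = Suc (Suc m)" using \<open>n \<ge> 2\<close> by (simp add: m_def)
  interpret Am: Vector_Spaces.linear scale scale "A ^^ m"
    using assms(2) by (rule linear_funpow)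
  let ?s = "\<Sum>i=1..n. b i"
  have "A (x i) = scale (b i) (\<Sum>k=1..n. x k) + \<phi> i" if "i \<in> {1..n}" for i
    using assms(4) that by (simp add: scale_sum_right)
  then have second_order: "A (A (x j)) - scale ?s (A (x j)) =
      A (\<phi> j) + (\<Sum>i\<in>{1..n} - {j}. scale (b j) (\<phi> i) - scale (b i) (\<phi> j))"
    using elimination_of_sum[OF assms(2) finite_atLeastAtMost _ j] by blast
  have "poly_op scale (char_poly (B_hat n b)) A (x j) =
      (A ^^ Suc (Suc m)) (x j) - scale ?s ((A ^^ Suc m) (x j))"
    unfolding n char_poly_B_hat by (rule poly_op_monom_minus_monom)
  also have "\<dots> = (A ^^ m) (A (A (x j)) - scale ?s (A (x j)))"
    by (simp add: Am.diff Am.scale funpow_swap1)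
  also have "\<dots> = (A ^^ Suc m) (\<phi> j) +
      (\<Sum>i\<in>{1..n} - {j}. scale (b j) ((A ^^ m) (\<phi> i)) - scale (b i) ((A ^^ m) (\<phi> j)))"
    unfolding second_order by (simp add: Am.add Am.sum Am.diff Am.scale funpow_swap1)
  finally show "poly_op scale (char_poly (B_hat n b)) A (x j) =
      (A ^^ (n - 1)) (\<phi> j) +
      (\<Sum>i\<in>{1..n} - {j}. scale (b j) ((A ^^ (n - 2)) (\<phi> i)) - scale (b i) ((A ^^ (n - 2)) (\<phi> j)))"
    by (simp add: n)
qed

end
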